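(* Let $n \geq 1$. Every derivation $D : \mathcal{T}^{+}(\mathcal{C}_n) \rightarrow \mathcal{T}^{+}(\mathcal{C}_n)$, i.e. every linear map (continuity is not assumed) satisfying $D(ab) = D(a)b + aD(b)$ for all $a,b \in \mathcal{T}^{+}(\mathcal{C}_n)$, is inner: there exists $X \in \mathcal{T}^{+}(\mathcal{C}_n)$ such that $D(a) = aX - Xa$ for all $a \in \mathcal{T}^{+}(\mathcal{C}_n)$.
   Context: $A(\mathbb{D})$ is the disk algebra: functions holomorphic on the open unit disk $\mathbb{D}$ and continuous on $\overline{\mathbb{D}}$, with the supremum norm. For $1 \leq i,j \leq n$ let $\ell(i,j) \in \{0,1,\dots,n-1\}$ be the residue of $j-i$ modulo $n$. The algebra $\mathcal{T}^{+}(\mathcal{C}_n)$ is the subalgebra of $M_n \otimes A(\mathbb{D}) = M_n(A(\mathbb{D}))$ consisting of all matrices $[z^{\ell(i,j)} f_{i,j}(z^n)]_{i,j=1}^n$ with $f_{i,j} \in A(\mathbb{D})$ for all $i,j$, with the norm inherited from $M_n \otimes A(\mathbb{D})$ (the supremum over $z \in \overline{\mathbb{D}}$ of the operator norm of the matrix at $z$). *)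

theory Defs
  imports "HOL-Complex_Analysis.Complex_Analysis" "Jordan_Normal_Form.Matrix"
begin

text \<open>
  HOL functions are total, so an element of the disk algebra is represented by its unique
  extension by zero outside the closed unit disk. In this way equality in the type is equality of
  functions on the closed disk.
\<close>

typedef disk_algebra =
  "{f :: complex \<Rightarrow> complex. f holomorphic_on ball 0 1 \<and> continuous_on (cball 0 1) f \<and>
      (\<forall>z. z \<notin> cball 0 1 \<longrightarrow> f z = 0)}"
  morphisms da_eval Abs_disk_algebra
  by (rule exI[of _ "\<lambda>_. 0"]) simp

setup_lifting type_definition_disk_algebra

lift_definition da_const :: "complex \<Rightarrow> disk_algebra"
  is "\<lambda>c z. if z \<in> cball 0 1 then c else 0"
proof -
  fix c :: complex
  let ?f = "\<lambda>z::complex. if z \<in> cball 0 1 then c else 0"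
  have "?f holomorphic_on ball 0 1 \<longleftrightarrow> (\<lambda>_. c) holomorphic_on ball 0 1"
    by (rule holomorphic_cong) auto
  moreover have "continuous_on (cball 0 1) ?f \<longleftrightarrow> continuous_on (cball 0 1) (\<lambda>_::complex. c)"
    by (rule continuous_on_cong) auto
  ultimately show "?f holomorphic_on ball 0 1 \<and> continuous_on (cball 0 1) ?f \<and>
      (\<forall>z. z \<notin> cball 0 1 \<longrightarrow> ?f z = 0)"
    by simp
qed

instantiation disk_algebra :: comm_ring_1
begin

lift_definition zero_disk_algebra :: disk_algebra is "\<lambda>_. 0" by simp
definition one_disk_algebra :: disk_algebra where "1 = da_const 1"
lift_definition plus_disk_algebra :: "disk_algebra \<Rightarrow> disk_algebra \<Rightarrow> disk_algebra"
  is "\<lambda>f g z. f z + g z" by (auto intro: holomorphic_intros continuous_intros)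
lift_definition minus_disk_algebra :: "disk_algebra \<Rightarrow> disk_algebra \<Rightarrow> disk_algebra"
  is "\<lambda>f g z. f z - g z" by (auto intro: holomorphic_intros continuous_intros)
lift_definition uminus_disk_algebra :: "disk_algebra \<Rightarrow> disk_algebra"
  is "\<lambda>f z. - f z" by (auto intro: holomorphic_intros continuous_intros)
lift_definition times_disk_algebra :: "disk_algebra \<Rightarrow> disk_algebra \<Rightarrow> disk_algebra"
  is "\<lambda>f g z. f z * g z" by (auto intro: holomorphic_intros continuous_intros)

instance
proof
  fix a :: disk_algebra
  show "1 * a = a"
    unfolding one_disk_algebra_def by transfer (auto simp: fun_eq_iff)
  have "da_eval 0 0 \<noteq> da_eval 1 0"
    unfolding one_disk_algebra_def by transfer simp
  then show "(0::disk_algebra) \<noteq> 1" by metis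
qed (transfer, auto simp: algebra_simps)+

end

definition residue_diff :: "nat \<Rightarrow> nat \<Rightarrow> nat \<Rightarrow> nat" where
  "residue_diff n i j = nat ((int j - int i) mod int n)"

text \<open>
  Rows and columns are numbered from 0 to n - 1 instead of from 1 to n; the residue of j - i
  is unaffected by this shift.
\<close>

definition cycle_algebra :: "nat \<Rightarrow> disk_algebra mat set" where
  "cycle_algebra n = {A \<in> carrier_mat n n.
     \<exists>f :: nat \<Rightarrow> nat \<Rightarrow> disk_algebra. \<forall>i<n. \<forall>j<n. \<forall>z\<in>cball 0 1.
       da_eval (A $$ (i, j)) z = z ^ residue_diff n i j * da_eval (f i j) (z ^ n)}"

text \<open>The scalar multiple of a matrix by a complex number c is \<open>da_const c \<cdot>\<^sub>m a\<close>.\<close>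

definition derivation_on :: "disk_algebra mat set \<Rightarrow> (disk_algebra mat \<Rightarrow> disk_algebra mat) \<Rightarrow> bool" where
  "derivation_on T D \<longleftrightarrow>
     (\<forall>a\<in>T. D a \<in> T) \<and>
     (\<forall>a\<in>T. \<forall>b\<in>T. D (a + b) = D a + D b) \<and>
     (\<forall>c. \<forall>a\<in>T. D (da_const c \<cdot>\<^sub>m a) = da_const c \<cdot>\<^sub>m D a) \<and>
     (\<forall>a\<in>T. \<forall>b\<in>T. D (a * b) = D a * b + a * D b)"

end

theory Submission imports Defs begin

text \<open>
  Let \<open>e\<^sub>i\<close> be the diagonal idempotents and let \<open>\<delta>\<^sub>i\<^sub>j\<close> be the \<open>(i, j)\<close> entry of \<open>D\<close> restricted to
  matrices supported at \<open>(i, j)\<close>. Expanding \<open>D (e\<^sub>i a e\<^sub>j)\<close> shows that \<open>D a\<close> differs from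
  \<open>(\<delta>\<^sub>i\<^sub>j (a\<^sub>i\<^sub>j))\<close> by the commutator of \<open>a\<close> with the matrix of off-diagonal entries of the
  \<open>- D e\<^sub>j\<close>. The map \<open>f \<mapsto> \<delta>\<^sub>i\<^sub>i (f(z\<^sup>n))\<close> is a derivation over \<open>f \<mapsto> f(z\<^sup>n)\<close>, and it vanishes:
  for unimodular \<open>\<zeta>\<close> the function \<open>1 - z / \<zeta>\<close> is a square \<open>s\<^sup>2\<close> with \<open>s(\<zeta>) = 0\<close>, so the derivative
  of the coordinate function is zero on the circle, hence zero, and then
  \<open>f - f(w) = (z - w) g\<close> gives the rest. Therefore \<open>\<delta>\<^sub>i\<^sub>j\<close> is multiplication by some \<open>h\<^sub>i\<^sub>j\<close> with
  \<open>h\<^sub>i\<^sub>j + h\<^sub>j\<^sub>k = h\<^sub>i\<^sub>k\<close>, which is the commutator with the diagonal matrix \<open>(h\<^sub>0\<^sub>j)\<close>.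
\<close>

section \<open>The disk algebra\<close>

lemma da_eval_simps [simp]:
  "da_eval 0 z = 0"
  "da_eval (f + g) z = da_eval f z + da_eval g z"
  "da_eval (f - g) z = da_eval f z - da_eval g z"
  "da_eval (- f) z = - da_eval f z"
  "da_eval (f * g) z = da_eval f z * da_eval g z"
  by (transfer, simp)+

lemma da_eval_const [simp]: "norm z \<le> 1 \<Longrightarrow> da_eval (da_const c) z = c"
  by transfer simp

lemma da_eval_one [simp]: "norm z \<le> 1 \<Longrightarrow> da_eval 1 z = 1"
  by (simp add: one_disk_algebra_def)

lemma da_eval_power [simp]: "norm z \<le> 1 \<Longrightarrow> da_eval (f ^ k) z = da_eval f z ^ k"
  by (induction k) auto

lemma da_eqI:
  assumes "\<And>z. norm z \<le> 1 \<Longrightarrow> da_eval f z = da_eval g z"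
  shows "f = g"
proof -
  have "da_eval h z = 0" if "\<not> norm z \<le> 1" for h z
    using that da_eval[of h] by simp
  with assms have "da_eval f = da_eval g"
    by (metis ext)
  then show ?thesis by (simp add: da_eval_inject)
qed

lemma da_continuous: "continuous_on (cball 0 1) (da_eval f)"
  and da_holomorphic: "da_eval f holomorphic_on ball 0 1"
  by (transfer, simp)+

lemma da_exists:
  assumes "f holomorphic_on ball 0 1" "continuous_on (cball 0 1) f"
  obtains g where "\<And>z. norm z \<le> 1 \<Longrightarrow> da_eval g z = f z"
proof
  let ?f = "\<lambda>z. if z \<in> cball 0 1 then f z else 0"
  have "?f holomorphic_on ball 0 1"
    using assms(1) by (rule holomorphic_transform) auto
  moreover have "continuous_on (cball 0 1) ?f"
    by (rule continuous_on_eq[OF assms(2)]) auto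
  ultimately show "da_eval (Abs_disk_algebra ?f) z = f z" if "norm z \<le> 1" for z
    using that by (subst Abs_disk_algebra_inverse) auto
qed

text \<open>The open disk is dense in the closed one, and \<open>f\<close> is continuous up to the
  boundary.\<close>

lemma da_eq_0_on_interiorI:
  assumes "\<And>z. norm z < 1 \<Longrightarrow> da_eval f z = 0"
  shows "f = 0"
proof (rule da_eqI)
  fix z :: complex assume z: "norm z \<le> 1"
  have "da_eval f z = 0"
  proof (rule continuous_constant_on_closure[of "ball 0 1 :: complex set" "da_eval f"])
    show "continuous_on (closure (ball 0 1)) (da_eval f)"
      by (simp add: da_continuous)
  qed (use assms z in auto)
  then show "da_eval f z = da_eval 0 z" by simp
qed

text \<open>Maximum modulus principle: \<open>f\<close> is bounded on the disk by its maximum on the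
  circle.\<close>

lemma da_eq_0_on_circleI:
  assumes "\<And>z. norm z = 1 \<Longrightarrow> da_eval f z = 0"
  shows "f = 0"
proof (rule da_eqI)
  fix z :: complex assume z: "norm z \<le> 1"
  have "norm (da_eval f z) \<le> 0"
  proof (rule maximum_modulus_frontier[of "da_eval f" "cball 0 1"])
    show "da_eval f holomorphic_on interior (cball 0 1)"
      by (simp add: da_holomorphic)
    show "continuous_on (closure (cball 0 1)) (da_eval f)"
      by (simp add: da_continuous)
  qed (use assms z in auto)
  then show "da_eval f z = da_eval 0 z" by simp
qed

section \<open>The coordinate function: cancellation, division and square roots\<close>

lift_definition da_z :: disk_algebra is "\<lambda>z. if z \<in> cball 0 1 then z else 0"
proof -
  have "(\<lambda>z::complex. if z \<in> cball 0 1 then z else 0) holomorphic_on ball 0 1"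
    by (rule holomorphic_transform[of "\<lambda>z. z"]) auto
  moreover have "continuous_on (cball 0 1) (\<lambda>z::complex. if z \<in> cball 0 1 then z else 0)"
    by (rule continuous_on_eq[OF continuous_on_id]) auto
  ultimately show "?thesis" by auto
qed

lemma da_eval_z [simp]: "norm z \<le> 1 \<Longrightarrow> da_eval da_z z = z"
  by transfer simp

text \<open>\<open>da_z\<close> has no zero on the unit circle, and vanishing there is
  enough.\<close>

lemma da_z_power_cancel:
  assumes "da_z ^ k * f = da_z ^ k * g"
  shows "f = g"
proof -
  have *: "da_eval (f - g) z = 0" if "norm z = 1" for z
  proof -
    have "da_eval (da_z ^ k * f) z = da_eval (da_z ^ k * g) z"
      by (simp add: assms)
    with that show ?thesis by auto
  qed
  have "f - g = 0" by (rule da_eq_0_on_circleI) (rule *)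
  then show ?thesis by simp
qed

text \<open>The difference quotient of \<open>f\<close> at \<open>w\<close> has a removable
  singularity. As \<open>w\<close> is interior, the quotient also stays continuous up to the circle;
  at a boundary point it could be unbounded.\<close>

lemma da_divide_linear:
  assumes "norm w < 1"
  obtains g where "f = da_const (da_eval f w) + (da_z - da_const w) * g"
proof -
  define F where "F = da_eval f"
  define q where "q z = (if z = w then deriv F w else (F z - F w) / (z - w))" for z
  have hol: "q holomorphic_on ball 0 1"
    unfolding q_def F_def by (intro pole_lemma_open da_holomorphic) auto
  have "continuous_on (cball 0 1) q"
    unfolding continuous_on_eq_continuous_within
  proof
    fix z :: complex assume z: "z \<in> cball 0 1"
    show "continuous (at z within cball 0 1) q"
    proof (cases "z = w")
      case True
      then have "isCont q z"
        using hol assms by (intro holomorphic_on_imp_continuous_on[THEN continuous_on_interior])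
           (auto simp: interior_open)
      then show ?thesis by (rule continuous_at_imp_continuous_at_within)
    next
      case False
      have "continuous (at z within cball 0 1) F"
        using da_continuous z unfolding F_def continuous_on_eq_continuous_within by blast
      then have "continuous (at z within cball 0 1) (\<lambda>z. (F z - F w) / (z - w))"
        using False by (intro continuous_intros) auto
      moreover have "eventually (\<lambda>x. x \<noteq> w) (at z within cball 0 1)"
        using False by (simp add: eventually_neq_at_within)
      then have "eventually (\<lambda>x. (F x - F w) / (x - w) = q x) (at z within cball 0 1)"
        by eventually_elim (simp add: q_def)
      ultimately show ?thesis
        using False unfolding continuous_within q_def
        by (auto elim!: Lim_transform_eventually simp: q_def)
    qed
  qed
  with hol obtain g where g: "\<And>z. norm z \<le> 1 \<Longrightarrow> da_eval g z = q z"
    using da_exists by blast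
  have "f = da_const (da_eval f w) + (da_z - da_const w) * g"
    by (rule da_eqI) (auto simp: g q_def F_def)
  then show thesis by (rule that)
qed

text \<open>The closed right half-plane meets the branch cut only at 0, and there
  \<open>norm (csqrt w) = sqrt (norm w)\<close> forces continuity.\<close>

lemma continuous_on_csqrt_halfplane: "continuous_on {z. Re z \<ge> 0} csqrt"
  unfolding continuous_on_eq_continuous_within
proof
  fix z assume z: "z \<in> {z. Re z \<ge> 0}"
  show "continuous (at z within {z. Re z \<ge> 0}) csqrt"
  proof (cases "z = 0")
    case True
    have "((\<lambda>w. sqrt (norm w)) \<longlongrightarrow> sqrt (norm (0::complex))) (at 0 within {z. Re z \<ge> 0})"
      by (intro tendsto_intros)
    then have "((\<lambda>w. norm (csqrt w)) \<longlongrightarrow> 0) (at 0 within {z. Re z \<ge> 0})"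
      by simp
    then show ?thesis
      using True tendsto_norm_zero_cancel[of csqrt] by (simp add: continuous_within)
  next
    case False
    with z have "z \<notin> \<real>\<^sub>\<le>\<^sub>0"
      by (auto simp: complex_nonpos_Reals_iff complex_eq_iff)
    then show ?thesis by (rule continuous_within_csqrt)
  qed
qed

text \<open>On the closed disk \<open>1 - cnj w * z\<close> has nonnegative real part, so its
  principal root is continuous there, and holomorphic inside, where the real part is positive. Its
  role is to write a linear function vanishing at the boundary point \<open>w\<close> as a product
  of two elements vanishing at \<open>w\<close>.\<close>

lemma da_sqrt_linear:
  assumes "norm w = 1"
  obtains s where "s * s = 1 - da_const (cnj w) * da_z" "da_eval s w = 0"
proof -
  let ?l = "\<lambda>z. 1 - cnj w * z"
  have le: "Re (cnj w * z) \<le> norm z" for z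
    using complex_Re_le_cmod[of "cnj w * z"] assms by (simp only: norm_mult complex_mod_cnj)
  have "(\<lambda>z. csqrt (?l z)) holomorphic_on ball 0 1"
  proof (intro holomorphic_intros)
    fix z :: complex assume "z \<in> ball 0 1"
    with le[of z] have "Re (?l z) > 0" by simp
    then show "?l z \<notin> \<real>\<^sub>\<le>\<^sub>0" by (auto simp: complex_nonpos_Reals_iff)
  qed
  moreover have "continuous_on (cball 0 1) (\<lambda>z. csqrt (?l z))"
  proof (rule continuous_on_compose2[OF continuous_on_csqrt_halfplane])
    show "?l ` cball 0 1 \<subseteq> {z. Re z \<ge> 0}"
    proof (intro image_subsetI CollectI)
      fix z :: complex assume "z \<in> cball 0 1"
      with le[of z] show "Re (?l z) \<ge> 0" by simp
    qed
  qed (intro continuous_intros)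
  ultimately obtain s where s: "\<And>z. norm z \<le> 1 \<Longrightarrow> da_eval s z = csqrt (?l z)"
    using da_exists by blast
  have "s * s = 1 - da_const (cnj w) * da_z"
    by (rule da_eqI) (simp add: s flip: power2_eq_square)
  moreover have "cnj w * w = 1"
    using assms by (simp add: complex_norm_square[symmetric] mult.commute)
  then have "da_eval s w = 0" using assms by (simp add: s)
  ultimately show thesis by (rule that)
qed

section \<open>Composition with a power of the coordinate\<close>

lemma power_comp_in_disk_algebra:
  fixes f :: "complex \<Rightarrow> complex"
  assumes "f holomorphic_on ball 0 1" "continuous_on (cball 0 1) f"
  shows "(\<lambda>z. if z \<in> cball 0 1 then f (z ^ n) else 0) holomorphic_on ball 0 1"
    and "continuous_on (cball 0 1) (\<lambda>z. if z \<in> cball 0 1 then f (z ^ n) else 0)"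
proof -
  have "(\<lambda>z. f (z ^ n)) holomorphic_on ball 0 1"
  \<comment> \<open>For \<open>n = 0\<close> the power map sends the open disk to the boundary point
    1, but the composite is constant.\<close>
  proof (cases "n = 0")
    case False
    have "f \<circ> (\<lambda>z. z ^ n) holomorphic_on ball 0 1"
    proof (rule holomorphic_on_compose_gen)
      show "(\<lambda>z. z ^ n) ` ball 0 1 \<subseteq> (ball 0 1 :: complex set)"
        using False by (auto simp: norm_power power_less_one_iff)
    qed (use assms in \<open>auto intro: holomorphic_intros\<close>)
    then show ?thesis by (simp add: o_def)
  qed simp
  then show "(\<lambda>z. if z \<in> cball 0 1 then f (z ^ n) else 0) holomorphic_on ball 0 1"
    by (rule holomorphic_transform) auto
  have "continuous_on (cball 0 1) (\<lambda>z. f (z ^ n))"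
    by (rule continuous_on_compose2[of "cball 0 1" f])
       (use assms in \<open>auto intro: continuous_intros simp: norm_power power_le_one\<close>)
  then show "continuous_on (cball 0 1) (\<lambda>z. if z \<in> cball 0 1 then f (z ^ n) else 0)"
    by (rule continuous_on_eq) auto
qed

text \<open>The unital endomorphism f \<mapsto> f(z^n). The case distinction preserves extension by
  zero even for \<open>n = 0\<close>, where \<open>z ^ n\<close> lies in the disk for every
  \<open>z\<close>.\<close>

lift_definition da_power_comp :: "nat \<Rightarrow> disk_algebra \<Rightarrow> disk_algebra"
  is "\<lambda>n f z. if z \<in> cball 0 1 then f (z ^ n) else 0"
  using power_comp_in_disk_algebra by simp

lemma da_eval_power_comp [simp]:
  "norm z \<le> 1 \<Longrightarrow> da_eval (da_power_comp n f) z = da_eval f (z ^ n)"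
  by transfer simp

lemma da_power_comp_simps:
  "da_power_comp n 0 = 0"
  "da_power_comp n 1 = 1"
  "da_power_comp n (da_const c) = da_const c"
  "da_power_comp n (f + g) = da_power_comp n f + da_power_comp n g"
  "da_power_comp n (f - g) = da_power_comp n f - da_power_comp n g"
  "da_power_comp n (- f) = - da_power_comp n f"
  "da_power_comp n (f * g) = da_power_comp n f * da_power_comp n g"
  "da_power_comp n da_z = da_z ^ n"
  by (rule da_eqI, simp add: norm_power power_le_one)+

text \<open>Followed by evaluation at \<open>w\<close>, \<open>\<delta>\<close> is a point
  derivation at \<open>w ^ n\<close>. Boundary points serve to kill \<open>\<delta> da_z\<close>,
  through square roots; interior points then serve for arbitrary \<open>f\<close>, through
  division.\<close>

lemma power_comp_derivation_eq_0:
  fixes \<delta> :: "disk_algebra \<Rightarrow> disk_algebra"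
  assumes n: "n \<ge> 1"
    and add: "\<And>f g. \<delta> (f + g) = \<delta> f + \<delta> g"
    and smult: "\<And>c f. \<delta> (da_const c * f) = da_const c * \<delta> f"
    and mult: "\<And>f g. \<delta> (f * g) = \<delta> f * da_power_comp n g + da_power_comp n f * \<delta> g"
  shows "\<delta> f = 0"
proof -
  have one: "\<delta> 1 = 0"
    using mult[of 1 1] by (simp add: da_power_comp_simps)
  have const: "\<delta> (da_const c) = 0" for c
    using smult[of c 1] by (simp add: one)
  have diff: "\<delta> (f - g) = \<delta> f - \<delta> g" for f g
    using add[of "f - g" g] by simp
  have "\<delta> da_z = 0"
  proof (rule da_eq_0_on_circleI)
    fix w :: complex assume w: "norm w = 1"
    then have wn: "norm (w ^ n) = 1" by (simp add: norm_power)
    obtain s where s: "s * s = 1 - da_const (cnj (w ^ n)) * da_z" "da_eval s (w ^ n) = 0"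
      using da_sqrt_linear[OF wn] .
    have "\<delta> (s * s) = - (da_const (cnj (w ^ n)) * \<delta> da_z)"
      unfolding s(1) diff one smult by simp
    \<comment> \<open>Both Leibniz terms contain \<open>da_power_comp n s\<close>, whose value at
      \<open>w\<close> is \<open>da_eval s (w ^ n) = 0\<close>.\<close>
    moreover have "da_eval (\<delta> (s * s)) w = 0"
      using w s(2) by (simp add: mult)
    ultimately have "cnj (w ^ n) * da_eval (\<delta> da_z) w = 0"
      using w by simp
    then show "da_eval (\<delta> da_z) w = 0" using w by auto
  qed
  show ?thesis
  proof (rule da_eq_0_on_interiorI)
    fix w :: complex assume w: "norm w < 1"
    then have wn: "norm (w ^ n) < 1" using n by (simp add: norm_power power_less_one_iff)
    obtain g where g: "f = da_const (da_eval f (w ^ n)) + (da_z - da_const (w ^ n)) * g"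
      using da_divide_linear[OF wn] .
    \<comment> \<open>Constants and \<open>da_z\<close> are killed, so one Leibniz term survives;
      its first factor is z^n - w^n, which vanishes at \<open>w\<close>.\<close>
    have "\<delta> f = (da_power_comp n da_z - da_const (w ^ n)) * \<delta> g"
      by (subst g) (simp add: add mult diff const \<open>\<delta> da_z = 0\<close> da_power_comp_simps)
    then show "da_eval (\<delta> f) w = 0" using w wn by simp
  qed
qed

section \<open>The algebra of the cycle\<close>

lemma residue_diff_self [simp]: "residue_diff n i i = 0"
  by (simp add: residue_diff_def)

text \<open>Both sides are congruent to \<open>k - i\<close>, and \<open>residue_diff n i k\<close>
  is already reduced. The overflow \<open>n * q\<close> is harmless later, since z^(nq) is a
  function of z^n.\<close>

lemma residue_diff_add:
  assumes "n \<ge> 1"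
  obtains q where "residue_diff n i j + residue_diff n j k = residue_diff n i k + n * q"
proof -
  have int: "int (residue_diff n i j) = (int j - int i) mod int n" for i j
    using assms by (simp add: residue_diff_def)
  have "int (residue_diff n i j + residue_diff n j k) mod int n = (int k - int i) mod int n"
    by (simp add: int mod_add_eq)
  then have "(residue_diff n i j + residue_diff n j k) mod n = residue_diff n i k"
    by (metis int of_nat_eq_iff of_nat_mod)
  then show thesis
    using that mod_mult_div_eq by metis
qed

text \<open>Stating the entry condition as a product in the ring, not pointwise, turns closure
  properties into ring identities. On the diagonal the residue is 0, so the set is the range of
  \<open>da_power_comp n\<close>.\<close>

definition cycle_entries :: "nat \<Rightarrow> nat \<Rightarrow> nat \<Rightarrow> disk_algebra set" where
  "cycle_entries n i j = range (\<lambda>f. da_z ^ residue_diff n i j * da_power_comp n f)"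

lemma cycle_entries_zero [simp]: "0 \<in> cycle_entries n i j"
  and cycle_entries_add:
    "f \<in> cycle_entries n i j \<Longrightarrow> g \<in> cycle_entries n i j \<Longrightarrow> f + g \<in> cycle_entries n i j"
  and cycle_entries_uminus: "f \<in> cycle_entries n i j \<Longrightarrow> - f \<in> cycle_entries n i j"
proof -
  show "0 \<in> cycle_entries n i j"
    unfolding cycle_entries_def by (rule range_eqI[of _ _ 0]) (simp add: da_power_comp_simps)
  show "f + g \<in> cycle_entries n i j"
    if "f \<in> cycle_entries n i j" "g \<in> cycle_entries n i j"
  proof -
    from that obtain f' g' where "f = da_z ^ residue_diff n i j * da_power_comp n f'"
      "g = da_z ^ residue_diff n i j * da_power_comp n g'"
      by (auto simp: cycle_entries_def)
    then have "f + g = da_z ^ residue_diff n i j * da_power_comp n (f' + g')"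
      by (simp add: da_power_comp_simps distrib_left)
    then show ?thesis unfolding cycle_entries_def by blast
  qed
  show "- f \<in> cycle_entries n i j" if "f \<in> cycle_entries n i j"
  proof -
    from that obtain f' where "f = da_z ^ residue_diff n i j * da_power_comp n f'"
      by (auto simp: cycle_entries_def)
    then have "- f = da_z ^ residue_diff n i j * da_power_comp n (- f')"
      by (simp add: da_power_comp_simps)
    then show ?thesis unfolding cycle_entries_def by blast
  qed
qed

lemma one_in_cycle_entries [simp]: "1 \<in> cycle_entries n i i"
  unfolding cycle_entries_def by (rule range_eqI[of _ _ 1]) (simp add: da_power_comp_simps)

lemma power_comp_in_cycle_entries [simp]: "da_power_comp n f \<in> cycle_entries n i i"
  unfolding cycle_entries_def by (rule range_eqI[of _ _ f]) simp

lemma z_power_in_cycle_entries [simp]: "da_z ^ residue_diff n i j \<in> cycle_entries n i j"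
  unfolding cycle_entries_def by (rule range_eqI[of _ _ 1]) (simp add: da_power_comp_simps)

lemma cycle_entries_iff:
  "a \<in> cycle_entries n i j \<longleftrightarrow>
    (\<exists>f. \<forall>z\<in>cball 0 1. da_eval a z = z ^ residue_diff n i j * da_eval f (z ^ n))"
proof -
  have "a = da_z ^ residue_diff n i j * da_power_comp n f \<longleftrightarrow>
      (\<forall>z\<in>cball 0 1. da_eval a z = z ^ residue_diff n i j * da_eval f (z ^ n))" for f
    by (auto intro: da_eqI)
  then show ?thesis unfolding cycle_entries_def image_iff by blast
qed

lemma cycle_algebra_iff:
  "A \<in> cycle_algebra n \<longleftrightarrow> A \<in> carrier_mat n n \<and> (\<forall>i<n. \<forall>j<n. A $$ (i, j) \<in> cycle_entries n i j)"
proof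
  assume "A \<in> carrier_mat n n \<and> (\<forall>i<n. \<forall>j<n. A $$ (i, j) \<in> cycle_entries n i j)"
  then have A: "A \<in> carrier_mat n n"
    \<comment> \<open>The index bounds are moved under the existential quantifier so that one choice
      function serves all entries.\<close>
    and "\<forall>i j. \<exists>f. i < n \<and> j < n \<longrightarrow> (\<forall>z\<in>cball 0 1.
       da_eval (A $$ (i, j)) z = z ^ residue_diff n i j * da_eval f (z ^ n))"
    unfolding cycle_entries_iff by blast+
  from this(2) obtain f where "\<forall>i j. i < n \<and> j < n \<longrightarrow> (\<forall>z\<in>cball 0 1.
       da_eval (A $$ (i, j)) z = z ^ residue_diff n i j * da_eval (f i j) (z ^ n))"
    unfolding choice_iff by blast
  with A show "A \<in> cycle_algebra n"
    unfolding cycle_algebra_def by blast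
qed (unfold cycle_algebra_def cycle_entries_iff, blast)

section \<open>Scaled matrix units\<close>

definition entry_mat :: "nat \<Rightarrow> nat \<Rightarrow> nat \<Rightarrow> 'a \<Rightarrow> 'a::zero mat" where
  "entry_mat n i j g = mat n n (\<lambda>(a, b). if a = i \<and> b = j then g else 0)"

lemma entry_mat_carrier [simp]: "entry_mat n i j g \<in> carrier_mat n n"
  by (simp add: entry_mat_def)

lemma entry_mat_dim [simp]: "dim_row (entry_mat n i j g) = n" "dim_col (entry_mat n i j g) = n"
  by (simp_all add: entry_mat_def)

lemma entry_mat_index [simp]:
  "a < n \<Longrightarrow> b < n \<Longrightarrow> entry_mat n i j g $$ (a, b) = (if a = i \<and> b = j then g else 0)"
  by (simp add: entry_mat_def)

lemma square_mat_mult_carrier [simp]: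
  "A \<in> carrier_mat n n \<Longrightarrow> B \<in> carrier_mat n n \<Longrightarrow> A * B \<in> carrier_mat n n"
  by (rule mult_carrier_mat)

lemma add_mat_index:
  "B \<in> carrier_mat n n \<Longrightarrow> i < n \<Longrightarrow> j < n \<Longrightarrow> (A + B) $$ (i, j) = A $$ (i, j) + B $$ (i, j)"
  by (rule index_add_mat) auto

lemma minus_mat_index:
  "B \<in> carrier_mat n n \<Longrightarrow> i < n \<Longrightarrow> j < n \<Longrightarrow> (A - B) $$ (i, j) = A $$ (i, j) - B $$ (i, j)"
  by (rule index_minus_mat) auto

lemma mult_mat_index:
  assumes "A \<in> carrier_mat n n" "B \<in> carrier_mat n n" "i < n" "j < n"
  shows "(A * B) $$ (i, j) = (\<Sum>k<n. A $$ (i, k) * B $$ (k, j))"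
  using assms by (auto simp: scalar_prod_def atLeast0LessThan intro!: sum.cong)

lemma mult_entry_mat_index:
  fixes A :: "'a::comm_ring_1 mat"
  assumes "A \<in> carrier_mat n n" "i < n" "a < n" "b < n"
  shows "(A * entry_mat n i j g) $$ (a, b) = (if b = j then A $$ (a, i) * g else 0)"
proof -
  have "(A * entry_mat n i j g) $$ (a, b)
      = (\<Sum>k<n. if k = i then if b = j then A $$ (a, i) * g else 0 else 0)"
    unfolding mult_mat_index[OF assms(1) entry_mat_carrier assms(3,4)]
    by (rule sum.cong) (use assms in auto)
  with assms show ?thesis by simp
qed

lemma entry_mat_mult_index:
  fixes A :: "'a::comm_ring_1 mat"
  assumes "A \<in> carrier_mat n n" "j < n" "a < n" "b < n"
  shows "(entry_mat n i j g * A) $$ (a, b) = (if a = i then g * A $$ (j, b) else 0)"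
proof -
  have "(entry_mat n i j g * A) $$ (a, b)
      = (\<Sum>k<n. if k = j then if a = i then g * A $$ (j, b) else 0 else 0)"
    unfolding mult_mat_index[OF entry_mat_carrier assms(1) assms(3,4)]
    by (rule sum.cong) (use assms in auto)
  with assms show ?thesis by simp
qed

lemma mat_eqI:
  assumes "A \<in> carrier_mat n n" "B \<in> carrier_mat n n"
    and "\<And>i j. i < n \<Longrightarrow> j < n \<Longrightarrow> A $$ (i, j) = B $$ (i, j)"
  shows "A = B"
  using assms by (intro eq_matI) auto

lemma entry_mat_mult:
  fixes g h :: "'a::comm_ring_1"
  assumes "j < n" "k < n"
  shows "entry_mat n i j g * entry_mat n k l h = (if j = k then entry_mat n i l (g * h) else 0\<^sub>m n n)"
  by (rule mat_eqI[of _ n])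
     (use assms in \<open>auto simp: mult_entry_mat_index simp del: index_mult_mat(1) split: if_splits\<close>)

lemma entry_mat_in_cycle_algebra [simp]:
  "g \<in> cycle_entries n i j \<Longrightarrow> entry_mat n i j g \<in> cycle_algebra n"
  by (auto simp: cycle_algebra_iff)

section \<open>Derivations\<close>

locale cycle_derivation =
  fixes n :: nat and D :: "disk_algebra mat \<Rightarrow> disk_algebra mat"
  assumes n_pos: "n \<ge> 1" and derivation: "derivation_on (cycle_algebra n) D"
begin

lemma D_add: "a \<in> cycle_algebra n \<Longrightarrow> b \<in> cycle_algebra n \<Longrightarrow> D (a + b) = D a + D b"
  and D_smult: "a \<in> cycle_algebra n \<Longrightarrow> D (da_const c \<cdot>\<^sub>m a) = da_const c \<cdot>\<^sub>m D a"
  and D_mult: "a \<in> cycle_algebra n \<Longrightarrow> b \<in> cycle_algebra n \<Longrightarrow> D (a * b) = D a * b + a * D b"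
  and D_closed [simp]: "a \<in> cycle_algebra n \<Longrightarrow> D a \<in> cycle_algebra n"
  using derivation by (auto simp: derivation_on_def)

lemma D_carrier [simp]: "a \<in> cycle_algebra n \<Longrightarrow> D a \<in> carrier_mat n n"
  using D_closed by (auto simp: cycle_algebra_iff)

lemma D_zero: "D (0\<^sub>m n n) = 0\<^sub>m n n"
proof (rule mat_eqI)
  have 0: "0\<^sub>m n n \<in> cycle_algebra n" by (auto simp: cycle_algebra_iff)
  then show "D (0\<^sub>m n n) \<in> carrier_mat n n" by simp
  fix i j assume ij: "i < n" "j < n"
  have "D (0\<^sub>m n n + 0\<^sub>m n n) $$ (i, j) = D (0\<^sub>m n n) $$ (i, j) + D (0\<^sub>m n n) $$ (i, j)"
    using 0 ij by (simp only: D_add add_mat_index[of _ n] D_carrier)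
  then show "D (0\<^sub>m n n) $$ (i, j) = 0\<^sub>m n n $$ (i, j)" using ij by simp
qed simp

text \<open>The compression of \<open>D\<close> to one corner: \<open>D\<close> may spread a matrix
  supported at \<open>(i, j)\<close> over other positions, and only the entry that stays in place is
  kept.\<close>

definition \<delta> :: "nat \<Rightarrow> nat \<Rightarrow> disk_algebra \<Rightarrow> disk_algebra" where
  "\<delta> i j g = D (entry_mat n i j g) $$ (i, j)"

lemma \<delta>_closed:
  assumes "i < n" "j < n" "g \<in> cycle_entries n i j"
  shows "\<delta> i j g \<in> cycle_entries n i j"
  using assms D_closed[of "entry_mat n i j g"] unfolding \<delta>_def cycle_algebra_iff by auto

lemma \<delta>_add:
  assumes "i < n" "j < n" "g \<in> cycle_entries n i j" "h \<in> cycle_entries n i j"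
  shows "\<delta> i j (g + h) = \<delta> i j g + \<delta> i j h"
proof -
  have "entry_mat n i j (g + h) = entry_mat n i j g + entry_mat n i j h"
    by (rule mat_eqI[of _ n]) auto
  with assms show ?thesis by (simp add: \<delta>_def D_add add_mat_index[of _ n])
qed

lemma \<delta>_smult:
  assumes "i < n" "j < n" "g \<in> cycle_entries n i j"
  shows "\<delta> i j (da_const c * g) = da_const c * \<delta> i j g"
proof -
  have "entry_mat n i j (da_const c * g) = da_const c \<cdot>\<^sub>m entry_mat n i j g"
    by (rule mat_eqI[of _ n]) auto
  with assms show ?thesis by (simp add: \<delta>_def D_smult carrier_matD[OF D_carrier])
qed

text \<open>In the \<open>(i, k)\<close> entry of the Leibniz expansion, multiplication by a scaled
  matrix unit selects exactly the compressed entry of the other factor.\<close>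

lemma \<delta>_mult:
  assumes "i < n" "j < n" "k < n" "g \<in> cycle_entries n i j" "h \<in> cycle_entries n j k"
  shows "\<delta> i k (g * h) = \<delta> i j g * h + g * \<delta> j k h"
proof -
  have "D (entry_mat n i k (g * h)) = D (entry_mat n i j g * entry_mat n j k h)"
    using assms by (simp add: entry_mat_mult)
  with assms show ?thesis
    by (simp add: \<delta>_def D_mult mult_entry_mat_index entry_mat_mult_index add_mat_index[of _ n]
      del: index_mult_mat(1))
qed

text \<open>Through f \<mapsto> f(z^n) the diagonal corner is an image of the disk algebra, so the
  vanishing of derivations over this map applies.\<close>

lemma \<delta>_diag: "i < n \<Longrightarrow> \<delta> i i (da_power_comp n f) = 0"
  by (rule power_comp_derivation_eq_0[OF n_pos, where \<delta> = "\<lambda>f. \<delta> i i (da_power_comp n f)"])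
     (simp_all add: da_power_comp_simps \<delta>_add \<delta>_smult \<delta>_mult)

text \<open>Since the diagonal compressions vanish, \<open>\<delta> i j\<close> is linear over
  functions of z^n and hence determined by its value on the generator
  \<open>da_z ^ residue_diff n i j\<close>. The additivity of \<open>h\<close> is the Leibniz rule
  on a product of two generators.\<close>

lemma \<delta>_eq_mult:
  obtains h where
    "\<And>i j g. i < n \<Longrightarrow> j < n \<Longrightarrow> g \<in> cycle_entries n i j \<Longrightarrow> \<delta> i j g = g * h i j"
    "\<And>i j. i < n \<Longrightarrow> j < n \<Longrightarrow> h i j \<in> range (da_power_comp n)"
    "\<And>i j k. i < n \<Longrightarrow> j < n \<Longrightarrow> k < n \<Longrightarrow> h i j + h j k = h i k"
proof -
  let ?z = "\<lambda>i j. da_z ^ residue_diff n i j"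
  \<comment> \<open>The image of the generator is again an allowed entry, hence the generator times
    a function of z^n; that function is \<open>h\<close>.\<close>
  have "\<forall>i j. \<exists>h. i < n \<and> j < n \<longrightarrow> \<delta> i j (?z i j) = ?z i j * h \<and> h \<in> range (da_power_comp n)"
  proof (intro allI)
    fix i j
    show "\<exists>h. i < n \<and> j < n \<longrightarrow> \<delta> i j (?z i j) = ?z i j * h \<and> h \<in> range (da_power_comp n)"
      using \<delta>_closed[of i j, OF _ _ z_power_in_cycle_entries] unfolding cycle_entries_def by auto
  qed
  then obtain h where h: "\<And>i j. i < n \<Longrightarrow> j < n \<Longrightarrow> \<delta> i j (?z i j) = ?z i j * h i j"
    "\<And>i j. i < n \<Longrightarrow> j < n \<Longrightarrow> h i j \<in> range (da_power_comp n)"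
    by metis
  have mult: "\<delta> i j g = g * h i j" if "i < n" "j < n" and g: "g \<in> cycle_entries n i j" for i j g
  proof -
    \<comment> \<open>The function of z^n is placed on the left, as an \<open>(i, i)\<close> entry,
      so that its Leibniz term contains the vanishing \<open>\<delta> i i\<close>.\<close>
    from g obtain f where f: "g = da_power_comp n f * ?z i j"
      by (auto simp: cycle_entries_def mult.commute)
    have "\<delta> i j g = da_power_comp n f * \<delta> i j (?z i j)"
      unfolding f using that by (simp add: \<delta>_mult[of i i j] \<delta>_diag)
    then show ?thesis using that by (simp add: f h(1) mult.assoc)
  qed
  have "h i j + h j k = h i k" if "i < n" "j < n" "k < n" for i j k
  proof -
    obtain q where q: "residue_diff n i j + residue_diff n j k = residue_diff n i k + n * q"
      using residue_diff_add[OF n_pos] .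
    have "?z i j * ?z j k = ?z i k * da_power_comp n (da_z ^ q)"
    proof -
      have "da_power_comp n (da_z ^ q) = da_z ^ (n * q)"
        by (rule da_eqI) (simp add: power_mult norm_power power_le_one)
      then show ?thesis by (simp add: q flip: power_add)
    qed
    then have "?z i j * ?z j k \<in> cycle_entries n i k"
      by (simp add: cycle_entries_def)
    \<comment> \<open>\<open>\<delta> i k\<close> of the product is computed twice: as
      multiplication by \<open>h i k\<close> and by Leibniz.\<close>
    then have "?z i j * ?z j k * h i k = \<delta> i j (?z i j) * ?z j k + ?z i j * \<delta> j k (?z j k)"
      using that by (simp add: \<delta>_mult flip: mult)
    also have "\<dots> = ?z i j * ?z j k * (h i j + h j k)"
      using that by (simp add: h(1) algebra_simps)
    finally show ?thesis
      using da_z_power_cancel[of "residue_diff n i j + residue_diff n j k"]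
      by (simp add: power_add)
  qed
  with h(2) mult show thesis using that by blast
qed

text \<open>For distinct indices \<open>D\<close> is applied to the zero product of the two
  idempotents; for equal ones idempotence gives \<open>x = x + x\<close>, so the entry is 0. This
  lets one matrix serve for both sums in the expansion of \<open>D a\<close>.\<close>

lemma D_idempotent_antisym:
  assumes "i < n" "k < n"
  shows "D (entry_mat n i i 1) $$ (i, k) = - D (entry_mat n k k 1) $$ (i, k)"
proof -
  have D_prod: "D (entry_mat n i i 1 * entry_mat n k k 1) $$ (i, k)
      = D (entry_mat n i i 1) $$ (i, k) + D (entry_mat n k k 1) $$ (i, k)"
    using assms by (simp add: D_mult mult_entry_mat_index entry_mat_mult_index add_mat_index[of _ n]
      del: index_mult_mat(1))
  show ?thesis
  proof (cases "i = k")
    case True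
    with D_prod assms show ?thesis by (simp add: entry_mat_mult)
  next
    case False
    with D_prod assms show ?thesis by (simp add: entry_mat_mult D_zero eq_neg_iff_add_eq_0)
  qed
qed

text \<open>Solve for \<open>D a\<close> in the Leibniz expansion of \<open>D\<close> at the triple
  product of the i-th idempotent, \<open>a\<close> and the j-th idempotent, which is the part of
  \<open>a\<close> supported at \<open>(i, j)\<close>.\<close>

lemma D_index:
  assumes a: "a \<in> cycle_algebra n" and ij: "i < n" "j < n"
  shows "D a $$ (i, j) = \<delta> i j (a $$ (i, j))
    - (\<Sum>k<n. D (entry_mat n i i 1) $$ (i, k) * a $$ (k, j))
    - (\<Sum>k<n. a $$ (i, k) * D (entry_mat n j j 1) $$ (k, j))"
proof -
  let ?ei = "entry_mat n i i (1 :: disk_algebra)"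
  let ?ej = "entry_mat n j j (1 :: disk_algebra)"
  have carr [simp]: "a \<in> carrier_mat n n" using a by (simp add: cycle_algebra_iff)
  have ea [simp]: "?ei * a \<in> cycle_algebra n"
    using a ij by (auto simp: cycle_algebra_iff entry_mat_mult_index simp del: index_mult_mat(1))
  have eac [simp]: "?ei * a \<in> carrier_mat n n" using ea by (simp only: cycle_algebra_iff)
  have "?ei * a * ?ej = entry_mat n i j (a $$ (i, j))"
    by (rule mat_eqI[of _ n])
       (use ij in \<open>auto simp: mult_entry_mat_index entry_mat_mult_index simp del: index_mult_mat(1)\<close>)
  then have "\<delta> i j (a $$ (i, j)) = D (?ei * a * ?ej) $$ (i, j)"
    by (simp add: \<delta>_def)
  also have "\<dots> = D (?ei * a) $$ (i, j) + (\<Sum>k<n. a $$ (i, k) * D ?ej $$ (k, j))"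
    using ij by (simp add: D_mult[of "?ei * a"] add_mat_index[of _ n] mult_entry_mat_index
      mult_mat_index[of "?ei * a" n "D ?ej"] entry_mat_mult_index del: index_mult_mat(1))
  also have "D (?ei * a) $$ (i, j) = (\<Sum>k<n. D ?ei $$ (i, k) * a $$ (k, j)) + D a $$ (i, j)"
    using ij a by (simp add: D_mult add_mat_index[of _ n] mult_mat_index[of "D ?ei" n] entry_mat_mult_index
      del: index_mult_mat(1))
  finally show ?thesis by (simp add: algebra_simps)
qed

lemma inner: "\<exists>X\<in>cycle_algebra n. \<forall>a\<in>cycle_algebra n. D a = a * X - X * a"
proof -
  obtain h where h: "\<And>i j g. i < n \<Longrightarrow> j < n \<Longrightarrow> g \<in> cycle_entries n i j \<Longrightarrow> \<delta> i j g = g * h i j"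
    "\<And>i j. i < n \<Longrightarrow> j < n \<Longrightarrow> h i j \<in> range (da_power_comp n)"
    "\<And>i j k. i < n \<Longrightarrow> j < n \<Longrightarrow> k < n \<Longrightarrow> h i j + h j k = h i k"
    using \<delta>_eq_mult by blast
  define Y where "Y k j = - D (entry_mat n j j 1) $$ (k, j)" for k j
  \<comment> \<open>The diagonal of \<open>Y\<close> is zero by antisymmetry. The diagonal added
    here is a potential for \<open>h\<close>: \<open>h i j = h 0 j - h 0 i\<close>, with base index
    0 available because \<open>n \<ge> 1\<close>.\<close>
  define X where "X = mat n n (\<lambda>(k, j). Y k j + (if k = j then h 0 j else 0))"
  have X_carrier [simp]: "X \<in> carrier_mat n n" by (simp add: X_def)
  have X_index: "X $$ (k, j) = Y k j + (if k = j then h 0 j else 0)" if "k < n" "j < n" for k j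
    using that by (simp add: X_def)
  have "X \<in> cycle_algebra n"
    unfolding cycle_algebra_iff
  proof (intro conjI allI impI X_carrier)
    fix k j assume kj: "k < n" "j < n"
    have "D (entry_mat n j j 1) $$ (k, j) \<in> cycle_entries n k j"
      using D_closed[of "entry_mat n j j 1"] kj unfolding cycle_algebra_iff by auto
    then have "Y k j \<in> cycle_entries n k j"
      unfolding Y_def by (rule cycle_entries_uminus)
    moreover have "(if k = j then h 0 j else 0) \<in> cycle_entries n k j"
      using h(2)[of 0 j] kj n_pos by auto
    ultimately show "X $$ (k, j) \<in> cycle_entries n k j"
      using kj by (simp add: X_index cycle_entries_add)
  qed
  moreover have "D a = a * X - X * a" if a: "a \<in> cycle_algebra n" for a
  proof (rule mat_eqI[of _ n])
    show "D a \<in> carrier_mat n n" using a by simp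
    have ac [simp]: "a \<in> carrier_mat n n" using a by (simp add: cycle_algebra_iff)
    show "a * X - X * a \<in> carrier_mat n n" by (intro minus_carrier_mat) simp
    fix i j assume ij: "i < n" "j < n"
    \<comment> \<open>Antisymmetry turns row \<open>i\<close> of the image of the i-th idempotent
      into row \<open>i\<close> of \<open>Y\<close>, which was defined by columns.\<close>
    have "(\<Sum>k<n. D (entry_mat n i i 1) $$ (i, k) * a $$ (k, j)) = (\<Sum>k<n. Y i k * a $$ (k, j))"
      using ij by (intro sum.cong) (simp_all add: Y_def D_idempotent_antisym[of i])
    then have "D a $$ (i, j) = a $$ (i, j) * h i j
        - (\<Sum>k<n. Y i k * a $$ (k, j)) + (\<Sum>k<n. a $$ (i, k) * Y k j)"
      using a ij by (simp add: D_index[OF a ij] h(1) cycle_algebra_iff sum_negf Y_def)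
    moreover have "h 0 i + h i j = h 0 j"
      using h(3)[of 0 i j] ij n_pos by simp
    then have "h i j = h 0 j - h 0 i"
      by (simp add: eq_diff_eq add.commute)
    ultimately have Da: "D a $$ (i, j) = a $$ (i, j) * (h 0 j - h 0 i)
        - (\<Sum>k<n. Y i k * a $$ (k, j)) + (\<Sum>k<n. a $$ (i, k) * Y k j)"
      by simp
    \<comment> \<open>The diagonal part of \<open>X\<close> contributes only at \<open>k = j\<close>
      here, and only at \<open>k = i\<close> in \<open>X * a\<close>; together they give the
      potential difference.\<close>
    have "(a * X) $$ (i, j) = (\<Sum>k<n. a $$ (i, k) * Y k j + (if k = j then a $$ (i, j) * h 0 j else 0))"
      unfolding mult_mat_index[OF ac X_carrier ij]
      by (rule sum.cong) (use ij in \<open>auto simp: X_index algebra_simps\<close>)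
    then have aX: "(a * X) $$ (i, j) = (\<Sum>k<n. a $$ (i, k) * Y k j) + a $$ (i, j) * h 0 j"
      using ij by (simp add: sum.distrib)
    have "(X * a) $$ (i, j) = (\<Sum>k<n. Y i k * a $$ (k, j) + (if k = i then h 0 i * a $$ (i, j) else 0))"
      unfolding mult_mat_index[OF X_carrier ac ij]
      by (rule sum.cong) (use ij in \<open>auto simp: X_index algebra_simps\<close>)
    then have Xa: "(X * a) $$ (i, j) = (\<Sum>k<n. Y i k * a $$ (k, j)) + h 0 i * a $$ (i, j)"
      using ij by (simp add: sum.distrib)
    have "(a * X - X * a) $$ (i, j) = (a * X) $$ (i, j) - (X * a) $$ (i, j)"
      using ij by (intro minus_mat_index[of _ n]) simp_all
    then show "D a $$ (i, j) = (a * X - X * a) $$ (i, j)"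
      unfolding Da aX Xa by (simp add: algebra_simps)
  qed
  ultimately show ?thesis by blast
qed

end

theorem corollary2:
  fixes n :: nat and D :: "disk_algebra mat \<Rightarrow> disk_algebra mat"
  assumes "n \<ge> 1"
    and "derivation_on (cycle_algebra n) D"
  shows "\<exists>X\<in>cycle_algebra n. \<forall>a\<in>cycle_algebra n. D a = a * X - X * a"
  using cycle_derivation.inner[of n D] assms by (simp add: cycle_derivation_def)

end
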